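(* Let $n\in\mathbb{N}=\{1,2,\ldots\}$. For every choice of constants $C_N>0$ $(N\in\mathbb{N})$ there exists a Fatou-Bieberbach domain $\Omega\subset\mathbb{C}^{2n+1}\setminus K$, where $$K=\bigcup_{N=1}^\infty 2^{N-1}\,b\mathbb{D}^{2n}_{(x,y)}\times C_N\overline{\mathbb{D}}_z\subset\mathbb{C}^{2n+1}.$$
   Context: Coordinates on $\mathbb{C}^{2n+1}$ are $(x,y,z)=(x_1,y_1,\ldots,x_n,y_n,z)$. Let $\mathbb{D}=\{\zeta\in\mathbb{C}:|\zeta|<1\}$ and $\overline{\mathbb{D}}=\{\zeta\in\mathbb{C}:|\zeta|\le 1\}$. Here $b\mathbb{D}^{2n}_{(x,y)}\subset\mathbb{C}^{2n}$ is the (topological) boundary of the unit polydisk in the $(x,y)$-space, $\overline{\mathbb{D}}_z$ is the closed unit disk in the $z$-direction, and $tA=\{ta:a\in A\}$ for $t>0$. A Fatou-Bieberbach domain in $\mathbb{C}^m$ is a proper subdomain $\Omega\subsetneq\mathbb{C}^m$ that is the image of an injective holomorphic map $\mathbb{C}^m\to\mathbb{C}^m$ (equivalently, is biholomorphic to $\mathbb{C}^m$). *)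

theory Defs
  imports "HOL-Analysis.Analysis"
begin

text \<open>
  \<open>\<complex>\<^sup>m\<close> is \<open>complex ^ 'm\<close> with \<open>m = CARD('m)\<close>. The library's holomorphy predicate covers only
  functions of one complex variable. A map between complex coordinate spaces is holomorphic if it
  is everywhere Frechet differentiable with complex-linear derivative, that is, with a derivative
  given by a complex (Jacobian) matrix.
\<close>

definition entire_map :: "(complex ^ 'm \<Rightarrow> complex ^ 'k) \<Rightarrow> bool" where
  "entire_map F \<longleftrightarrow>
     (\<forall>a. \<exists>J :: complex ^ 'm ^ 'k. (F has_derivative (\<lambda>v. J *v v)) (at a))"

definition fatou_bieberbach_domain :: "(complex ^ 'm) set \<Rightarrow> bool" where
  "fatou_bieberbach_domain \<Omega> \<longleftrightarrow>
     open \<Omega> \<and> connected \<Omega> \<and> \<Omega> \<noteq> {} \<and> \<Omega> \<noteq> UNIV \<and>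
     (\<exists>F :: complex ^ 'm \<Rightarrow> complex ^ 'm. entire_map F \<and> inj F \<and> range F = \<Omega>)"

definition unit_polydisk :: "(complex ^ 'm) set" where
  "unit_polydisk = {w. \<forall>i. cmod (w $ i) < 1}"

text \<open>
  With \<open>n = CARD('n)\<close>, the coordinates of \<open>\<complex>\<^sup>2\<^sup>n\<^sup>+\<^sup>1\<close> are indexed by \<open>('n + 'n) + unit\<close>:
  \<open>x\<^sub>j\<close> has index \<open>Inl (Inl j)\<close>, \<open>y\<^sub>j\<close> has index \<open>Inl (Inr j)\<close> and \<open>z\<close> has index \<open>Inr ()\<close>.
\<close>

type_synonym 'n coords = "('n + 'n) + unit"

definition xy_part :: "complex ^ ('n::finite) coords \<Rightarrow> complex ^ ('n + 'n)" where
  "xy_part p = (\<chi> i. p $ Inl i)"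

definition z_part :: "complex ^ ('n::finite) coords \<Rightarrow> complex" where
  "z_part p = p $ Inr ()"

text \<open>
  The scalings apply to the factors separately: the \<open>N\<close>-th piece is the product of
  \<open>2\<^sup>N\<^sup>-\<^sup>1 b\<D>\<^sup>2\<^sup>n\<close> and \<open>C\<^sub>N\<close> times the closed unit disk. The value \<open>C 0\<close> is not used.
\<close>

definition K_set :: "(nat \<Rightarrow> real) \<Rightarrow> (complex ^ ('n::finite) coords) set" where
  "K_set C = (\<Union>N\<in>{1..}.
     {p. xy_part p \<in> (\<lambda>w. 2 ^ (N - 1) *\<^sub>R w) ` frontier unit_polydisk \<and>
         z_part p \<in> (\<lambda>\<zeta>. C N *\<^sub>R \<zeta>) ` cball 0 1})"

end

theory Submission
  imports Defs "HOL-Complex_Analysis.Cauchy_Integral_Formula"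
begin

text \<open>
  The \<open>N\<close>-th piece of \<open>K\<close> is a wall: at each of its points some coordinate other than \<open>z\<close> has
  modulus exactly \<open>2\<^sup>N\<^sup>-\<^sup>1\<close>, no other coordinate except \<open>z\<close> is larger, and \<open>z\<close> is bounded by \<open>C\<^sub>N\<close>. The
  idea is to move all walls by one automorphism into a region at infinity that a basin of attraction
  is known to miss.

  The region consists of the points at which the largest modulus is attained at a coordinate other
  than the last one and is at least \<open>2\<close>. The polynomial automorphism
  \<open>H(u\<^sub>0, \<dots>, u\<^sub>d) = (u\<^sub>0\<^sup>2 + u\<^sub>1/2, \<dots>, u\<^sub>d\<^sub>-\<^sub>1\<^sup>2 + u\<^sub>d/2, u\<^sub>0/2)\<close> maps this region into itself
  (\<open>henon_escaping\<close>), because all coordinates but the last are squared. Its linear part at the fixed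
  point \<open>0\<close> is half of a permutation matrix, so \<open>H\<close> is conjugate to its linear part on the basin of
  attraction of \<open>0\<close> (\<open>entire_linearization\<close>). The conjugating map is an injective entire map \<open>F\<close>
  whose image misses the region (\<open>ex_entire_injection_not_escaping\<close>).

  To move the walls, take the automorphism
  \<open>S(u\<^sub>0, \<dots>, u\<^sub>d) = (\<phi>(u\<^sub>0) + u\<^sub>1, \<dots>, \<phi>(u\<^sub>d\<^sub>-\<^sub>1) + u\<^sub>d, u\<^sub>0)\<close> with \<open>u\<^sub>d = z\<close>, where \<open>\<phi>\<close> is an entire
  function of one variable that is very large on all the circles of radius \<open>2\<^sup>N\<^sup>-\<^sup>1\<close>
  (\<open>ex_entire_large_on_circles\<close>). As there are several \<open>x\<close> and \<open>y\<close> coordinates, no scalar entire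
  function of them tends to infinity along the boundaries of these polydisks: its zero set is
  unbounded or empty, and both are impossible. But the vector \<open>(\<phi>(u\<^sub>0), \<dots>, \<phi>(u\<^sub>d\<^sub>-\<^sub>1))\<close> does if \<open>\<phi>\<close>
  is large enough, and the spare coordinate \<open>z\<close> makes room to complete it to an automorphism. The
  last coordinate of the image is the harmless \<open>u\<^sub>0\<close>. Therefore \<open>S\<close> maps \<open>K\<close> into the region, and
  the image of \<open>F\<close> followed by the inverse of \<open>S\<close> is the domain.
\<close>

section \<open>Entire maps of several variables\<close>

lemma norm_vec_smult: "norm (c *s v) = cmod c * norm v" for v :: "complex ^ 'k"
  by (simp add: norm_vec_def norm_mult L2_set_right_distrib)

lemma norm_vec_le_sum: "norm v \<le> (\<Sum>i\<in>UNIV. cmod (v $ i))" for v :: "complex ^ 'k"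
  by (simp add: norm_vec_def L2_set_le_sum)

text \<open>
  A real-linear map that commutes with multiplication by \<open>\<i>\<close> is complex-linear. This is the form
  in which complex linearity is checked below: it is an equation, so it passes to limits and to
  components.
\<close>

lemma complex_matrix_of_derivative:
  fixes D :: "complex ^ 'm \<Rightarrow> complex ^ 'k"
  assumes D: "(F has_derivative D) (at a)"
    and i: "\<And>v. D (\<i> *s v) = \<i> *s D v"
  shows "\<exists>J. (F has_derivative (\<lambda>v. J *v v)) (at a)"
proof -
  interpret D: bounded_linear D
    using D by (rule has_derivative_bounded_linear)
  have split: "c *s v = Re c *\<^sub>R v + Im c *\<^sub>R (\<i> *s v)" for c and v :: "complex ^ 'j"
  proof (rule vec_eq_iff[THEN iffD2], rule allI)
    fix k
    have "c * v $ k = (complex_of_real (Re c) + \<i> * complex_of_real (Im c)) * v $ k"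
      by (simp flip: complex_eq)
    then show "(c *s v) $ k = (Re c *\<^sub>R v + Im c *\<^sub>R (\<i> *s v)) $ k"
      by (simp only: vector_add_component vector_scaleR_component vector_smult_component)
        (simp add: scaleR_conv_of_real algebra_simps)
  qed
  have "Vector_Spaces.linear (*s) (*s) D"
  proof unfold_locales
    show "D (c *s v) = c *s D v" for c v
      by (simp only: split[of c] D.add D.scaleR i)
  qed (auto simp: D.add)
  then have "D = (\<lambda>v. matrix D *v v)"
    by (auto simp: matrix_works)
  then show ?thesis
    using D by metis
qed

lemma entire_map_componentwise:
  fixes F :: "complex ^ 'm \<Rightarrow> complex ^ 'k"
  shows "entire_map F \<longleftrightarrow>
    (\<forall>k a. \<exists>D. ((\<lambda>p. F p $ k) has_derivative D) (at a) \<and> (\<forall>v. D (\<i> *s v) = \<i> * D v))"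
    (is "_ \<longleftrightarrow> ?R")
proof
  assume "entire_map F"
  show ?R
  proof (intro allI)
    fix k a
    obtain J where "(F has_derivative (\<lambda>v. J *v v)) (at a)"
      using \<open>entire_map F\<close> unfolding entire_map_def by blast
    then have "((\<lambda>p. F p $ k) has_derivative (\<lambda>v. (J *v v) $ k)) (at a)"
      by (rule bounded_linear.has_derivative[OF bounded_linear_vec_nth])
    then show "\<exists>D. ((\<lambda>p. F p $ k) has_derivative D) (at a) \<and> (\<forall>v. D (\<i> *s v) = \<i> * D v)"
      by (auto simp: vector_scalar_commute)
  qed
next
  assume R: ?R
  show "entire_map F"
    unfolding entire_map_def
  proof
    fix a
    have "\<forall>k. \<exists>D. ((\<lambda>p. F p $ k) has_derivative D) (at a) \<and> (\<forall>v. D (\<i> *s v) = \<i> * D v)"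
      using R by blast
    from choice[OF this] obtain D where D: "\<And>k. ((\<lambda>p. F p $ k) has_derivative D k) (at a)"
      and i: "\<And>k v. D k (\<i> *s v) = \<i> * D k v"
      by blast
    have lin: "linear (D k)" for k
      using has_derivative_linear[OF D] .
    have "linear (\<lambda>v. \<chi> k. D k v)"
      by (auto intro!: linearI simp: vec_eq_iff linear_add[OF lin] linear_scale[OF lin])
    moreover have "((\<lambda>y. ((F y - F a) - (\<chi> k. D k (y - a))) /\<^sub>R norm (y - a)) \<longlongrightarrow> 0) (at a)"
    proof (rule vec_tendstoI)
      show "((\<lambda>y. (((F y - F a) - (\<chi> k. D k (y - a))) /\<^sub>R norm (y - a)) $ k)
          \<longlongrightarrow> 0 $ k) (at a)" for k
        using D[of k] by (simp add: has_derivative_at_within)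
    qed
    ultimately have "(F has_derivative (\<lambda>v. \<chi> k. D k v)) (at a)"
      by (simp add: has_derivative_at_within linear_conv_bounded_linear)
    then show "\<exists>J. (F has_derivative (\<lambda>v. J *v v)) (at a)"
      by (rule complex_matrix_of_derivative) (simp add: vec_eq_iff i)
  qed
qed

lemma entire_map_continuous: "entire_map F \<Longrightarrow> continuous_on S F"
  unfolding entire_map_def
  by (metis continuous_at_imp_continuous_on has_derivative_continuous)

lemma entire_map_compose:
  assumes "entire_map F" "entire_map G"
  shows "entire_map (\<lambda>p. G (F p))"
  unfolding entire_map_def
proof
  fix a
  obtain J where "(F has_derivative (\<lambda>v. J *v v)) (at a)"
    using assms(1) unfolding entire_map_def by blast
  moreover obtain L where "(G has_derivative (\<lambda>v. L *v v)) (at (F a))"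
    using assms(2) unfolding entire_map_def by blast
  ultimately have "((\<lambda>p. G (F p)) has_derivative (\<lambda>v. L *v (J *v v))) (at a)"
    by (rule has_derivative_compose)
  then show "\<exists>J. ((\<lambda>p. G (F p)) has_derivative (\<lambda>v. J *v v)) (at a)"
    by (auto simp: matrix_vector_mul_assoc)
qed

lemma entire_map_funpow:
  fixes F :: "complex ^ 'm \<Rightarrow> complex ^ 'm"
  assumes "entire_map F"
  shows "entire_map (F ^^ n)"
proof (induction n)
  case 0
  have "(id has_derivative (\<lambda>v. mat 1 *v v)) (at a)" for a :: "complex ^ 'm"
    unfolding matrix_vector_mul_lid id_def by (rule has_derivative_ident)
  then show ?case
    unfolding entire_map_def by (simp only: funpow.simps) blast
next
  case (Suc n)
  then show ?case
    using entire_map_compose[OF Suc assms] by (simp add: o_def)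
qed

text \<open>
  This is the Cauchy estimate in one variable for the components of the restriction of \<open>F\<close> to the
  complex line through \<open>a\<close> in the direction \<open>v\<close>. The factor \<open>CARD('k)\<close> comes from bounding the
  Euclidean norm by the sum of the moduli of the components.
\<close>

lemma entire_map_Cauchy_estimate:
  fixes F :: "complex ^ 'm \<Rightarrow> complex ^ 'k"
  assumes F: "entire_map F" and D: "(F has_derivative D) (at a)"
    and r: "0 < r" and B: "\<And>p. p \<in> cball a r \<Longrightarrow> norm (F p) \<le> B"
  shows "norm (D v) \<le> real CARD('k) * (B / r) * norm v"
proof (cases "v = 0")
  case True
  interpret D: bounded_linear D
    using D by (rule has_derivative_bounded_linear)
  show ?thesis
    using True by (simp add: D.zero)
next
  case False
  have "cmod (D v $ k) \<le> B / r * norm v" for k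
  proof -
    define g where "g = (\<lambda>\<zeta>. F (a + \<zeta> *s v) $ k)"
    have line: "((\<lambda>\<zeta>. a + \<zeta> *s v) has_derivative (\<lambda>\<eta>. \<eta> *s v)) (at \<zeta>)" for \<zeta>
    proof -
      have "linear (\<lambda>\<eta>. \<eta> *s v)"
        by (rule linearI) (simp_all add: vec_eq_iff algebra_simps)
      then have "((\<lambda>\<eta>. \<eta> *s v) has_derivative (\<lambda>\<eta>. \<eta> *s v)) (at \<zeta>)"
        by (simp add: bounded_linear_imp_has_derivative linear_conv_bounded_linear)
      from has_derivative_add[OF has_derivative_const this] show ?thesis
        by simp
    qed
    have der: "(g has_field_derivative E v $ k) (at \<zeta>)"
      if E: "(F has_derivative E) (at (a + \<zeta> *s v))" and lin: "\<And>\<eta>. E (\<eta> *s v) = \<eta> *s E v" for E \<zeta>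
    proof -
      have "((\<lambda>\<zeta>. F (a + \<zeta> *s v)) has_derivative (\<lambda>\<eta>. E (\<eta> *s v))) (at \<zeta>)"
        by (rule has_derivative_compose[OF line E])
      then have "(g has_derivative (\<lambda>\<eta>. E (\<eta> *s v) $ k)) (at \<zeta>)"
        unfolding g_def by (rule bounded_linear.has_derivative[OF bounded_linear_vec_nth])
      then show ?thesis
        by (simp add: has_field_derivative_def lin mult_commute_abs)
    qed
    obtain J where J: "\<And>p. (F has_derivative (\<lambda>v. J p *v v)) (at p)"
      using F unfolding entire_map_def by metis
    have D_eq: "D = (\<lambda>v. J a *v v)"
      using has_derivative_unique[OF D J] .
    have hol: "g holomorphic_on S" for S
      unfolding holomorphic_on_def field_differentiable_def
      using der[OF J vector_scalar_commute] has_field_derivative_at_within by blast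
    have "cmod ((deriv ^^ 1) g 0) \<le> fact 1 * B / (r / norm v) ^ 1"
    proof (rule Cauchy_inequality)
      show "0 < r / norm v"
        using r False by simp
      fix \<zeta> assume "cmod (0 - \<zeta>) = r / norm v"
      then have "norm (F (a + \<zeta> *s v)) \<le> B"
        using False by (intro B) (simp add: dist_norm norm_vec_smult)
      then show "cmod (g \<zeta>) \<le> B"
        unfolding g_def by (meson Finite_Cartesian_Product.norm_nth_le order_trans)
    qed (use hol in \<open>auto intro: holomorphic_on_imp_continuous_on\<close>)
    moreover have "deriv g 0 = D v $ k"
      using der[of D 0] D by (auto simp: D_eq vector_scalar_commute intro!: DERIV_imp_deriv)
    ultimately show ?thesis
      by simp
  qed
  then have "(\<Sum>k\<in>UNIV. cmod (D v $ k)) \<le> (\<Sum>k\<in>(UNIV :: 'k set). B / r * norm v)"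
    by (intro sum_mono) auto
  then show ?thesis
    using norm_vec_le_sum[of "D v"] by simp
qed

text \<open>
  This is the theorem of Weierstrass: by the Cauchy estimate, uniform convergence on a ball gives uniform
  convergence of the derivatives on a smaller ball, and limits of complex-linear maps are
  complex-linear.
\<close>

lemma uniform_limit_entire_differentiable:
  fixes F :: "nat \<Rightarrow> complex ^ 'm \<Rightarrow> complex ^ 'k"
  assumes F: "\<And>n. entire_map (F n)" and r: "0 < r"
    and lim: "uniform_limit (ball a r) F G sequentially"
  shows "\<exists>J. (G has_derivative (\<lambda>v. J *v v)) (at a)"
proof -
  obtain J where J: "\<And>n p. (F n has_derivative (\<lambda>v. J n p *v v)) (at p)"
    using F unfolding entire_map_def by metis
  define S where "S = ball a (r / 2)"
  define c where "c = real CARD('k) / (r / 3)"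
  have c: "0 < c"
    using r by (simp add: c_def)
  have sub: "cball p (r / 3) \<subseteq> ball a r" if "p \<in> S" for p
  proof
    fix q assume "q \<in> cball p (r / 3)"
    then show "q \<in> ball a r"
      using that r dist_triangle[of a q p] by (simp add: S_def)
  qed
  have Cauchy_J: "\<exists>N. \<forall>m\<ge>N. \<forall>n\<ge>N. \<forall>p\<in>S. \<forall>v. norm (J m p *v v - J n p *v v) \<le> e * norm v"
    if "0 < e" for e
  proof -
    have "uniformly_Cauchy_on (ball a r) F"
      using lim by (auto intro!: uniformly_convergent_Cauchy simp: uniformly_convergent_on_def)
    then obtain N where N: "\<And>q m n. q \<in> ball a r \<Longrightarrow> m \<ge> N \<Longrightarrow> n \<ge> N \<Longrightarrow> dist (F m q) (F n q) < e / c"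
      unfolding uniformly_Cauchy_on_def using \<open>0 < e\<close> c by (meson divide_pos_pos)
    have "norm (J m p *v v - J n p *v v) \<le> e * norm v"
      if mn: "m \<ge> N" "n \<ge> N" and p: "p \<in> S" for m n p v
    proof -
      have der: "((\<lambda>q. F m q - F n q) has_derivative (\<lambda>v. J m p *v v - J n p *v v)) (at p)" for p
        by (intro has_derivative_diff J)
      have "entire_map (\<lambda>q. F m q - F n q)"
        unfolding entire_map_def
      proof
        show "\<exists>L. ((\<lambda>q. F m q - F n q) has_derivative (\<lambda>v. L *v v)) (at p)" for p
          using der[of p] by (intro exI[of _ "J m p - J n p"]) (simp add: matrix_vector_mult_diff_rdistrib)
      qed
      from entire_map_Cauchy_estimate[OF this der, of "r / 3" p "e / c" v]
      have "norm (J m p *v v - J n p *v v) \<le> real CARD('k) * (e / c / (r / 3)) * norm v"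
        using N[of _ m n] mn sub[OF p] r by (force simp: dist_norm)
      also have "real CARD('k) * (e / c / (r / 3)) = e"
        using r by (simp add: c_def)
      finally show ?thesis .
    qed
    then show ?thesis
      by blast
  qed
  define D where "D = (\<lambda>p v. lim (\<lambda>n. J n p *v v))"
  have D: "(\<lambda>n. J n p *v v) \<longlonglongrightarrow> D p v" if p: "p \<in> S" for p v
  proof -
    have "Cauchy (\<lambda>n. J n p *v v)"
    proof (rule metric_CauchyI)
      fix e :: real assume "0 < e"
      define e' where "e' = e / (norm v + 1)"
      have "0 < e'"
        using \<open>0 < e\<close> by (simp add: e'_def add_nonneg_pos)
      moreover have "e' * norm v < e"
        using \<open>0 < e\<close> by (simp add: e'_def divide_simps add_nonneg_pos)
      moreover obtain N where "\<forall>m\<ge>N. \<forall>n\<ge>N. \<forall>p\<in>S. \<forall>v. norm (J m p *v v - J n p *v v) \<le> e' * norm v"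
        using Cauchy_J[OF \<open>0 < e'\<close>] by blast
      ultimately show "\<exists>N. \<forall>m\<ge>N. \<forall>n\<ge>N. dist (J m p *v v) (J n p *v v) < e"
        using p unfolding dist_norm by (meson order_le_less_trans)
    qed
    then have "convergent (\<lambda>n. J n p *v v)"
      by (rule Cauchy_convergent)
    then show ?thesis
      unfolding D_def convergent_LIMSEQ_iff .
  qed
  have "\<exists>g. \<forall>p\<in>S. (\<lambda>n. F n p) \<longlonglongrightarrow> g p \<and> (g has_derivative D p) (at p within S)"
  proof (rule has_derivative_sequence)
    show "convex S"
      by (simp add: S_def)
    show "(F n has_derivative (\<lambda>v. J n p *v v)) (at p within S)" for n p
      by (rule has_derivative_at_withinI[OF J])
    show "a \<in> S"
      using r by (simp add: S_def)
    show "(\<lambda>n. F n a) \<longlonglongrightarrow> G a"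
      by (rule tendsto_uniform_limitI[OF lim]) (simp add: r)
    fix e :: real assume "0 < e"
    then obtain N where N: "\<And>m n p v. m \<ge> N \<Longrightarrow> n \<ge> N \<Longrightarrow> p \<in> S \<Longrightarrow>
        norm (J m p *v v - J n p *v v) \<le> e * norm v"
      using Cauchy_J by meson
    have "norm (J n p *v v - D p v) \<le> e * norm v" if "n \<ge> N" "p \<in> S" for n p v
    proof (rule Lim_norm_ubound)
      show "(\<lambda>m. J n p *v v - J m p *v v) \<longlonglongrightarrow> J n p *v v - D p v"
        by (intro tendsto_intros D that)
      show "\<forall>\<^sub>F m in sequentially. norm (J n p *v v - J m p *v v) \<le> e * norm v"
        using N that unfolding eventually_sequentially by blast
    qed simp
    then show "\<forall>\<^sub>F n in sequentially. \<forall>p\<in>S. \<forall>v. norm (J n p *v v - D p v) \<le> e * norm v"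
      unfolding eventually_sequentially by blast
  qed
  then obtain g where g: "\<And>p. p \<in> S \<Longrightarrow> (\<lambda>n. F n p) \<longlonglongrightarrow> g p"
      "\<And>p. p \<in> S \<Longrightarrow> (g has_derivative D p) (at p within S)"
    by blast
  have aS: "a \<in> S" "open S"
    using r by (auto simp: S_def)
  have gG: "g p = G p" if "p \<in> S" for p
  proof (rule LIMSEQ_unique[OF g(1)[OF that]])
    show "(\<lambda>n. F n p) \<longlonglongrightarrow> G p"
      using that r by (intro tendsto_uniform_limitI[OF lim]) (simp add: S_def)
  qed
  have "(g has_derivative D a) (at a)"
    using g(2)[OF aS(1)] unfolding at_within_open[OF aS] .
  then have "(G has_derivative D a) (at a)"
    using aS(2,1) gG by (rule has_derivative_transform_within_open)
  moreover have "D a (\<i> *s v) = \<i> *s D a v" for v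
  proof (rule LIMSEQ_unique[OF D[OF aS(1)]])
    have "(\<lambda>n. \<i> *s (J n a *v v)) \<longlonglongrightarrow> \<i> *s D a v"
    proof (rule vec_tendstoI)
      show "(\<lambda>n. (\<i> *s (J n a *v v)) $ k) \<longlonglongrightarrow> (\<i> *s D a v) $ k" for k
        using tendsto_mult_left[OF tendsto_vec_nth[OF D[OF aS(1), of v], of k]] by simp
    qed
    then show "(\<lambda>n. J n a *v (\<i> *s v)) \<longlonglongrightarrow> \<i> *s D a v"
      by (simp add: vector_scalar_commute)
  qed
  ultimately show ?thesis
    by (rule complex_matrix_of_derivative)
qed

section \<open>Linearization at an attracting fixed point\<close>

text \<open>
  Poincare's linearization at an attracting fixed point, written for the inverse map: \<open>g\<close> expands
  near its fixed point \<open>0\<close>, and \<open>A\<close> is the inverse of its linear part. The map \<open>F\<close> is the limit of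
  \<open>g\<^sup>k \<circ> A\<^sup>k\<close>. As \<open>g \<circ> A\<close> is the identity up to a quadratic error, replacing \<open>k\<close> by \<open>k + 1\<close> changes
  the map by an error of size \<open>c\<^sup>2\<^sup>k\<close> at the innermost step, and the \<open>k\<close> outer applications of \<open>g\<close>
  magnify it by roughly \<open>c\<close> to the power \<open>-k\<close>. Hence the limit exists near \<open>0\<close>. The two powers
  of \<open>c\<close> compare so well because \<open>A\<close> scales the norm of every vector by the same factor.
  Away from \<open>0\<close> the equation \<open>F = g\<^sup>n \<circ> F \<circ> A\<^sup>n\<close> transports convergence, differentiability and
  injectivity from a neighbourhood of \<open>0\<close>, into which \<open>A\<^sup>n\<close> carries every point.
\<close>

theorem entire_linearization:
  fixes g A B :: "complex ^ 'm \<Rightarrow> complex ^ 'm"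
  assumes g: "entire_map g" "inj g" "g 0 = 0"
    and A: "entire_map A" "linear A" "\<And>p. norm (A p) = c * norm p" "\<And>p. A (B p) = p"
    and c: "0 < c" "c < 1"
    and Q: "0 < Q" "\<And>p q. norm p \<le> 1 \<Longrightarrow> norm q \<le> 1 \<Longrightarrow>
      norm (g (A p) - g (A q) - (p - q)) \<le> Q * norm (p - q) * (norm p + norm q)"
  obtains F where "entire_map F" "inj F" "F 0 = 0" "F = g \<circ> F \<circ> A"
proof -
  define Fk where "Fk = (\<lambda>k p. (g ^^ k) ((A ^^ k) p))"
  have Fk_0: "Fk 0 p = p" for p
    by (simp add: Fk_def)
  have Fk_add: "Fk (n + k) p = (g ^^ n) (Fk k ((A ^^ n) p))" for n k p
    unfolding Fk_def by (metis add.commute comp_apply funpow_add)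
  have Fk_Suc: "Fk (Suc k) p = g (Fk k (A p))" for k p
    using Fk_add[of 1 k p] by simp
  have entire_Fk: "entire_map (Fk k)" for k
    unfolding Fk_def
    by (rule entire_map_compose[OF entire_map_funpow[OF A(1)] entire_map_funpow[OF g(1)]])
  have A0: "A 0 = 0"
    using A(2) by (rule linear_0)
  have normB: "norm (B p) = norm p / c" for p
    using A(3)[of "B p"] A(4)[of p] c by (simp add: field_simps)
  have norm_An: "norm ((A ^^ n) p) = c ^ n * norm p" for n p
    by (induction n) (simp_all add: A)
  have An_diff: "(A ^^ n) (p - q) = (A ^^ n) p - (A ^^ n) q" for n p q
    by (induction n) (simp_all add: linear_diff[OF A(2)])

  define \<theta> where "\<theta> = (1 + c) / 2"
  have \<theta>: "0 < \<theta>" "\<theta> < 1"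
    using c by (auto simp: \<theta>_def)
  define \<rho> where "\<rho> = min 1 ((1 - c) / (4 * Q))"
  have \<rho>: "0 < \<rho>" "\<rho> \<le> 1" "\<rho> * (4 * Q) \<le> 1 - c"
    using c Q(1) by (auto simp: \<rho>_def min_def field_simps)
  \<comment> \<open>In the ball of radius \<open>\<rho>\<close> the conjugate \<open>g \<circ> A\<close> stretches distances by so little that,
      together with one factor \<open>c\<close>, a contraction remains.\<close>
  have lip: "c * norm (g (A p) - g (A q)) \<le> \<theta> * norm (p - q)"
    if "norm p \<le> \<rho>" "norm q \<le> \<rho>" for p q
  proof -
    have "norm (g (A p) - g (A q)) \<le> norm (p - q) + norm (g (A p) - g (A q) - (p - q))"
      by (metis add.commute diff_add_cancel norm_triangle_ineq)
    also have "\<dots> \<le> norm (p - q) + Q * norm (p - q) * (norm p + norm q)"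
      using Q(2)[of p q] that \<rho> by simp
    also have "\<dots> \<le> norm (p - q) + Q * norm (p - q) * (2 * \<rho>)"
      using that Q(1) by (intro add_left_mono mult_left_mono) auto
    also have "\<dots> = (1 + 2 * (Q * \<rho>)) * norm (p - q)"
      by (simp add: algebra_simps)
    finally have "c * norm (g (A p) - g (A q)) \<le> c * ((1 + 2 * (Q * \<rho>)) * norm (p - q))"
      using c by (intro mult_left_mono) auto
    then have "c * norm (g (A p) - g (A q)) \<le> (c * (1 + 2 * (Q * \<rho>))) * norm (p - q)"
      by (simp only: mult.assoc)
    also have "\<dots> \<le> \<theta> * norm (p - q)"
    proof (rule mult_right_mono)
      have "c * (2 * (Q * \<rho>)) \<le> 1 * (2 * (Q * \<rho>))"
        using c Q(1) \<rho> by (intro mult_right_mono) auto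
      then show "c * (1 + 2 * (Q * \<rho>)) \<le> \<theta>"
        using \<rho>(3) by (simp add: \<theta>_def algebra_simps)
    qed simp
    finally show ?thesis .
  qed

  \<comment> \<open>\<open>K\<close> is the sum of the geometric series of the bounds on \<open>Fk (Suc k) - Fk k\<close>; the choice of
      \<open>\<delta>\<close> makes all \<open>Fk k\<close> at most double the norm, so that \<open>lip\<close> stays applicable.\<close>
  define K where "K = Q / (1 - \<theta>)"
  have K: "0 < K"
    using Q(1) \<theta> by (simp add: K_def)
  define \<delta> where "\<delta> = min (\<rho> / 2) (1 / K)"
  have \<delta>: "0 < \<delta>" "2 * \<delta> \<le> \<rho>" "K * \<delta> \<le> 1"
    using K \<rho> by (auto simp: \<delta>_def min_def field_simps)
  have key: "norm (Fk (Suc k) q - Fk k q) \<le> Q * \<theta> ^ k * (norm q)\<^sup>2 \<and>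
      norm (Fk k q - q) \<le> K * (1 - \<theta> ^ k) * (norm q)\<^sup>2" if "norm q \<le> \<delta>" for k q
    using that
  proof (induction k arbitrary: q)
    case 0
    then show ?case
      using Q(2)[of q 0] \<delta> \<rho> by (simp add: Fk_Suc Fk_0 A0 g power2_eq_square mult.assoc)
  next
    case (Suc k)
    have K\<theta>: "K * (1 - \<theta> ^ k) + Q * \<theta> ^ k = K * (1 - \<theta> ^ Suc k)"
      using \<theta> by (simp add: K_def field_simps)
    have next_diff: "norm (Fk (Suc k) q - q) \<le> K * (1 - \<theta> ^ Suc k) * (norm q)\<^sup>2"
      if "norm q \<le> \<delta>" for q
    proof -
      have "norm (Fk (Suc k) q - q) \<le> norm (Fk (Suc k) q - Fk k q) + norm (Fk k q - q)"
        by (metis diff_add_cancel diff_diff_eq2 add_diff_eq norm_triangle_ineq)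
      also have "\<dots> \<le> (K * (1 - \<theta> ^ k) + Q * \<theta> ^ k) * (norm q)\<^sup>2"
        using Suc.IH[OF that] by (simp add: algebra_simps)
      finally show ?thesis
        by (simp only: K\<theta>)
    qed
    have small: "norm x \<le> 2 * norm q"
      if "norm q \<le> \<delta>" "norm (x - q) \<le> K * (1 - \<theta> ^ j) * (norm q)\<^sup>2" for x q j
    proof -
      have "K * (1 - \<theta> ^ j) * (norm q)\<^sup>2 \<le> K * 1 * (norm q)\<^sup>2"
        using K \<theta> by (intro mult_right_mono mult_left_mono) auto
      also have "\<dots> \<le> (K * \<delta>) * norm q"
        using that(1) K by (simp add: power2_eq_square mult_right_mono mult_left_mono)
      also have "\<dots> \<le> 1 * norm q"
        using \<delta> by (intro mult_right_mono) auto
      finally have "norm (x - q) \<le> norm q"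
        using that(2) by simp
      then show ?thesis
        using norm_triangle_ineq[of "x - q" q] by simp
    qed
    let ?q = "A q"
    have Aq: "norm ?q \<le> \<delta>"
      using Suc.prems c mult_left_le_one_le[of "norm q" c] by (simp add: A)
    have b: "norm (B (Fk k ?q)) \<le> \<rho>" "norm (B (Fk (Suc k) ?q)) \<le> \<rho>"
      using small[OF Aq conjunct2[OF Suc.IH[OF Aq]]] small[OF Aq next_diff[OF Aq]] c \<delta> Suc.prems
      by (auto simp: normB A field_simps intro: order_trans)
    have "Fk (Suc (Suc k)) q - Fk (Suc k) q = g (A (B (Fk (Suc k) ?q))) - g (A (B (Fk k ?q)))"
      by (simp add: Fk_Suc A)
    then have "c * norm (Fk (Suc (Suc k)) q - Fk (Suc k) q)
        \<le> \<theta> * norm (B (Fk (Suc k) ?q) - B (Fk k ?q))"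
      using lip[OF b(2) b(1)] by simp
    also have "norm (B (Fk (Suc k) ?q) - B (Fk k ?q)) = norm (Fk (Suc k) ?q - Fk k ?q) / c"
      using A(3)[of "B (Fk (Suc k) ?q) - B (Fk k ?q)"] c
      by (simp add: linear_diff[OF A(2)] A field_simps)
    also have "\<theta> * (norm (Fk (Suc k) ?q - Fk k ?q) / c) \<le> \<theta> * (Q * \<theta> ^ k * (norm ?q)\<^sup>2 / c)"
      using Suc.IH[OF Aq] \<theta> c by (intro mult_left_mono divide_right_mono) auto
    also have "\<dots> = c * (Q * \<theta> ^ Suc k * (norm q)\<^sup>2)"
      using c by (simp add: A power2_eq_square field_simps)
    finally show ?case
      using next_diff[OF Suc.prems] c by simp
  qed

  define F where "F = (\<lambda>p. lim (\<lambda>k. Fk k p))"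
  have lim_F: "uniform_limit (ball 0 \<delta>) Fk F sequentially"
  proof -
    let ?S = "\<lambda>q. \<Sum>k. Fk (Suc k) q - Fk k q"
    have "uniform_limit (ball 0 \<delta>) (\<lambda>n q. \<Sum>k<n. Fk (Suc k) q - Fk k q) ?S sequentially"
    proof (rule Weierstrass_m_test)
      show "norm (Fk (Suc k) q - Fk k q) \<le> Q * \<delta>\<^sup>2 * \<theta> ^ k" if "q \<in> ball 0 \<delta>" for k q
      proof -
        have "norm (Fk (Suc k) q - Fk k q) \<le> Q * \<theta> ^ k * (norm q)\<^sup>2"
          using that key by simp
        also have "\<dots> \<le> Q * \<theta> ^ k * \<delta>\<^sup>2"
          using that Q(1) \<theta> by (intro mult_left_mono power_mono) auto
        finally show ?thesis
          by (simp add: mult_ac)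
      qed
      show "summable (\<lambda>k. Q * \<delta>\<^sup>2 * \<theta> ^ k)"
        using \<theta> by (intro summable_mult summable_geometric) auto
    qed
    then have "uniform_limit (ball 0 \<delta>) (\<lambda>n q. Fk n q - q) ?S sequentially"
      by (simp add: sum_lessThan_telescope[of "\<lambda>n. Fk n _"] Fk_0)
    from uniform_limit_add[OF this uniform_limit_const[where c = "\<lambda>q. q"]]
    have *: "uniform_limit (ball 0 \<delta>) Fk (\<lambda>q. ?S q + q) sequentially"
      by simp
    then have "uniformly_convergent_on (ball 0 \<delta>) Fk"
      unfolding uniformly_convergent_on_def by blast
    then show ?thesis
      unfolding F_def uniformly_convergent_uniform_limit_iff .
  qed
  \<comment> \<open>From here on, statements near \<open>0\<close> are spread to the whole space: every orbit of \<open>A\<close> enters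
      the small ball, and \<open>g\<^sup>n\<close> leads back.\<close>
  have enter: "eventually (\<lambda>n. norm ((A ^^ n) p) < \<delta>) sequentially" for p
  proof -
    have "(\<lambda>n. c ^ n * norm p) \<longlonglongrightarrow> 0 * norm p"
      using c by (intro tendsto_mult_right LIMSEQ_realpow_zero) auto
    then show ?thesis
      using \<delta>(1) by (auto simp: norm_An dest: order_tendstoD(2))
  qed
  have cont_gn: "isCont (g ^^ n) q" for n q
    using entire_map_continuous[OF entire_map_funpow[OF g(1)], of UNIV]
    by (simp add: continuous_on_eq_continuous_at)
  have lim_extend: "(\<lambda>k. Fk k p) \<longlonglongrightarrow> (g ^^ n) L" if "(\<lambda>k. Fk k ((A ^^ n) p)) \<longlonglongrightarrow> L" for n p L
  proof (rule LIMSEQ_offset)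
    show "(\<lambda>k. Fk (k + n) p) \<longlonglongrightarrow> (g ^^ n) L"
      using isCont_tendsto_compose[OF cont_gn that] by (simp add: Fk_add[of n _ p] add.commute[of _ n])
  qed
  have Fk_tendsto: "(\<lambda>k. Fk k p) \<longlonglongrightarrow> F p" for p
  proof -
    obtain n where "norm ((A ^^ n) p) < \<delta>"
      using enter[of p] by (auto simp: eventually_sequentially)
    then have "(\<lambda>k. Fk k ((A ^^ n) p)) \<longlonglongrightarrow> F ((A ^^ n) p)"
      by (intro tendsto_uniform_limitI[OF lim_F]) simp
    from lim_extend[OF this] show ?thesis
      unfolding F_def by (simp add: limI)
  qed
  have F_iter: "F p = (g ^^ n) (F ((A ^^ n) p))" for n p
    using LIMSEQ_unique[OF Fk_tendsto lim_extend[OF Fk_tendsto]] .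
  have F_id: "norm (F q - q) \<le> K * (norm q)\<^sup>2" if "norm q < \<delta>" for q
  proof (rule Lim_norm_ubound)
    show "(\<lambda>k. Fk k q - q) \<longlonglongrightarrow> F q - q"
      by (intro tendsto_intros Fk_tendsto)
    have "K * (1 - \<theta> ^ k) * (norm q)\<^sup>2 \<le> K * 1 * (norm q)\<^sup>2" for k
      using K \<theta> by (intro mult_right_mono mult_left_mono) auto
    then show "\<forall>\<^sub>F k in sequentially. norm (Fk k q - q) \<le> K * (norm q)\<^sup>2"
      using key[of q] that by (intro always_eventually) (fastforce intro: order_trans)
  qed simp

  have local_diff: "\<exists>J. (F has_derivative (\<lambda>v. J *v v)) (at q)" if "norm q < \<delta>" for q
  proof (rule uniform_limit_entire_differentiable[OF entire_Fk])
    show "0 < \<delta> - norm q"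
      using that by simp
    have "ball q (\<delta> - norm q) \<subseteq> ball 0 \<delta>"
      by (simp add: ball_subset_ball_iff)
    then show "uniform_limit (ball q (\<delta> - norm q)) Fk F sequentially"
      using lim_F by (rule uniform_limit_on_subset[rotated])
  qed
  have "entire_map F"
    unfolding entire_map_def
  proof
    fix p
    obtain n where n: "norm ((A ^^ n) p) < \<delta>"
      using enter[of p] by (auto simp: eventually_sequentially)
    obtain J1 where 1: "((A ^^ n) has_derivative (\<lambda>v. J1 *v v)) (at p)"
      using entire_map_funpow[OF A(1)] unfolding entire_map_def by blast
    obtain J2 where 2: "(F has_derivative (\<lambda>v. J2 *v v)) (at ((A ^^ n) p))"
      using local_diff[OF n] by blast
    obtain J3 where 3: "((g ^^ n) has_derivative (\<lambda>v. J3 *v v)) (at (F ((A ^^ n) p)))"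
      using entire_map_funpow[OF g(1)] unfolding entire_map_def by blast
    have "((\<lambda>p. (g ^^ n) (F ((A ^^ n) p))) has_derivative (\<lambda>v. J3 *v (J2 *v (J1 *v v)))) (at p)"
      by (rule has_derivative_compose[OF has_derivative_compose[OF 1 2] 3])
    then show "\<exists>J. (F has_derivative (\<lambda>v. J *v v)) (at p)"
      by (auto simp: matrix_vector_mul_assoc simp flip: F_iter)
  qed
  moreover have "inj F"
  proof (rule injI)
    fix p q assume Fpq: "F p = F q"
    have same: "F ((A ^^ n) p) = F ((A ^^ n) q)" for n
      using Fpq F_iter[of p n] F_iter[of q n] inj_fn[OF g(2), of n] by (metis injD)
    \<comment> \<open>\<open>F\<close> agrees with the identity up to a quadratic error, so the images of the two orbits can
        only agree if the orbits approach each other faster than the linear map \<open>A\<close> allows.\<close>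
    have "\<forall>\<^sub>F n in sequentially. norm (p - q) \<le> c ^ n * (K * ((norm p)\<^sup>2 + (norm q)\<^sup>2))"
      using enter[of p] enter[of q]
    proof eventually_elim
      case (elim n)
      have "(A ^^ n) (p - q) = (F ((A ^^ n) q) - (A ^^ n) q) - (F ((A ^^ n) p) - (A ^^ n) p)"
        by (simp add: An_diff same)
      then have "c ^ n * norm (p - q)
          \<le> norm (F ((A ^^ n) q) - (A ^^ n) q) + norm (F ((A ^^ n) p) - (A ^^ n) p)"
        by (metis norm_An norm_triangle_ineq4)
      also have "\<dots> \<le> K * (norm ((A ^^ n) q))\<^sup>2 + K * (norm ((A ^^ n) p))\<^sup>2"
        using elim by (intro add_mono F_id)
      also have "\<dots> = c ^ n * (c ^ n * (K * ((norm p)\<^sup>2 + (norm q)\<^sup>2)))"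
        by (simp add: norm_An power2_eq_square algebra_simps)
      finally show ?case
        using c by simp
    qed
    moreover have "(\<lambda>n. c ^ n * (K * ((norm p)\<^sup>2 + (norm q)\<^sup>2))) \<longlonglongrightarrow> 0"
      using c tendsto_mult_right[OF LIMSEQ_realpow_zero[of c]] by fastforce
    ultimately have "norm (p - q) \<le> 0"
      by (intro tendsto_lowerbound[of _ 0 sequentially "norm (p - q)"]) auto
    then show "p = q"
      by simp
  qed
  moreover have "F 0 = 0"
    using F_id[of 0] \<delta>(1) by simp
  moreover have "F = g \<circ> F \<circ> A"
  proof
    show "F p = (g \<circ> F \<circ> A) p" for p
      using F_iter[of p 1] by simp
  qed
  ultimately show thesis
    by (rule that)
qed

section \<open>Triangular automorphisms of Henon type\<close>

locale coordinate_enumeration =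
  fixes e :: "nat \<Rightarrow> 'm::finite" and d :: nat
  assumes e: "bij_betw e {..d} UNIV" and d: "0 < d"
begin

text \<open>
  The index type has no order of its own, so the coordinates are enumerated as
  \<open>u\<^sub>0, \<dots>, u\<^sub>d\<close> with \<open>u\<^sub>k = u $ e k\<close>; the last one will be \<open>z\<close>.
\<close>

definition pos :: "'m \<Rightarrow> nat" where
  "pos = the_inv_into {..d} e"

lemma pos_e: "k \<le> d \<Longrightarrow> pos (e k) = k"
  unfolding pos_def using e by (intro the_inv_into_f_f) (auto simp: bij_betw_def)

lemma ex_index: obtains k where "k \<le> d" "i = e k"
  using e by (metis UNIV_I atMost_iff bij_betw_def imageE)

lemma vec_eqI: "(\<And>k. k \<le> d \<Longrightarrow> u $ e k = v $ e k) \<Longrightarrow> u = v"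
  by (metis ex_index vec_eq_iff)

lemma norm_sum: "(norm u)\<^sup>2 = (\<Sum>k\<le>d. (cmod (u $ e k))\<^sup>2)" for u :: "complex ^ 'm"
proof -
  have "(norm u)\<^sup>2 = (\<Sum>i\<in>UNIV. (cmod (u $ i))\<^sup>2)"
    by (simp add: norm_vec_def L2_set_def sum_nonneg)
  also have "\<dots> = (\<Sum>k\<le>d. (cmod (u $ e k))\<^sup>2)"
    by (rule sum.reindex_bij_betw[OF e, symmetric])
  finally show ?thesis .
qed

text \<open>
  In the enumerated coordinates this is
  \<open>(u\<^sub>0, \<dots>, u\<^sub>d) \<mapsto> (\<phi>(u\<^sub>0) + c u\<^sub>1, \<dots>, \<phi>(u\<^sub>d\<^sub>-\<^sub>1) + c u\<^sub>d, c u\<^sub>0)\<close>,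
  which for \<open>d = 1\<close> is a classical Henon map. It applies \<open>\<phi>\<close> to all coordinates but one at the same
  time and is nevertheless invertible for every \<open>\<phi>\<close>: the last component gives \<open>u\<^sub>0\<close>, then the
  component \<open>k\<close> gives \<open>u\<^sub>k\<^sub>+\<^sub>1\<close> from \<open>u\<^sub>k\<close>.
\<close>

definition henon :: "(complex \<Rightarrow> complex) \<Rightarrow> complex \<Rightarrow> complex ^ 'm \<Rightarrow> complex ^ 'm" where
  "henon \<phi> c u = (\<chi> i. if pos i < d then \<phi> (u $ i) + c * u $ e (Suc (pos i)) else c * u $ e 0)"

primrec solve :: "(complex \<Rightarrow> complex) \<Rightarrow> complex \<Rightarrow> complex ^ 'm \<Rightarrow> nat \<Rightarrow> complex" where
  "solve \<phi> c b 0 = b $ e d / c"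
| "solve \<phi> c b (Suc k) = (b $ e k - \<phi> (solve \<phi> c b k)) / c"

definition henon_inv :: "(complex \<Rightarrow> complex) \<Rightarrow> complex \<Rightarrow> complex ^ 'm \<Rightarrow> complex ^ 'm" where
  "henon_inv \<phi> c b = (\<chi> i. solve \<phi> c b (pos i))"

lemma henon_less: "k < d \<Longrightarrow> henon \<phi> c u $ e k = \<phi> (u $ e k) + c * u $ e (Suc k)"
  by (simp add: henon_def pos_e)

lemma henon_last: "henon \<phi> c u $ e d = c * u $ e 0"
  by (simp add: henon_def pos_e)

lemma henon_inv_nth: "k \<le> d \<Longrightarrow> henon_inv \<phi> c b $ e k = solve \<phi> c b k"
  by (simp add: henon_inv_def pos_e)

lemma henon_henon_inv:
  assumes "c \<noteq> 0"
  shows "henon \<phi> c (henon_inv \<phi> c b) = b"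
proof (rule vec_eqI)
  fix k assume "k \<le> d"
  then show "henon \<phi> c (henon_inv \<phi> c b) $ e k = b $ e k"
    using assms by (cases "k = d") (simp_all add: henon_less henon_last henon_inv_nth)
qed

lemma inj_henon_inv: "c \<noteq> 0 \<Longrightarrow> inj (henon_inv \<phi> c)"
  by (metis henon_henon_inv injI)

lemma entire_henon_inv:
  assumes \<phi>: "\<phi> holomorphic_on UNIV"
  shows "entire_map (henon_inv \<phi> c)"
  unfolding entire_map_componentwise
proof (intro allI)
  fix i a
  have "\<exists>D. ((\<lambda>b. solve \<phi> c b k) has_derivative D) (at a) \<and> (\<forall>v. D (\<i> *s v) = \<i> * D v)" for k
  proof (induction k)
    case 0
    have "((\<lambda>b. b $ e d / c) has_derivative (\<lambda>v. v $ e d / c)) (at a)"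
      by (intro bounded_linear_imp_has_derivative
          bounded_linear_compose[OF bounded_linear_divide bounded_linear_vec_nth])
    then show ?case
      by (auto intro!: exI[of _ "\<lambda>v. v $ e d / c"])
  next
    case (Suc k)
    then obtain D where D: "((\<lambda>b. solve \<phi> c b k) has_derivative D) (at a)"
      and i: "\<And>v. D (\<i> *s v) = \<i> * D v"
      by blast
    obtain \<phi>' where "(\<phi> has_field_derivative \<phi>') (at (solve \<phi> c a k))"
      using \<phi> by (auto simp: holomorphic_on_def field_differentiable_def)
    then have "(\<phi> has_derivative (\<lambda>w. \<phi>' * w)) (at (solve \<phi> c a k))"
      by (simp add: has_field_derivative_def)
    then have "((\<lambda>b. \<phi> (solve \<phi> c b k)) has_derivative (\<lambda>v. \<phi>' * D v)) (at a)"
      using D by (rule has_derivative_compose[rotated])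
    moreover have "((\<lambda>b. b $ e k) has_derivative (\<lambda>v. v $ e k)) (at a)"
      by (intro bounded_linear_imp_has_derivative bounded_linear_vec_nth)
    ultimately have "((\<lambda>b. b $ e k - \<phi> (solve \<phi> c b k)) has_derivative (\<lambda>v. v $ e k - \<phi>' * D v)) (at a)"
      by (intro has_derivative_diff)
    then have "((\<lambda>b. (b $ e k - \<phi> (solve \<phi> c b k)) / c) has_derivative
        (\<lambda>v. (v $ e k - \<phi>' * D v) / c)) (at a)"
      by (rule bounded_linear.has_derivative[OF bounded_linear_divide])
    then show ?case
      by (intro exI[of _ "\<lambda>v. (v $ e k - \<phi>' * D v) / c"]) (simp add: i algebra_simps diff_divide_distrib)
  qed
  then show "\<exists>D. ((\<lambda>b. henon_inv \<phi> c b $ i) has_derivative D) (at a) \<and> (\<forall>v. D (\<i> *s v) = \<i> * D v)"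
    by (simp add: henon_inv_def)
qed

text \<open>For \<open>\<phi> = 0\<close> the map is \<open>c\<close> times a permutation of the coordinates.\<close>

lemma
  shows linear_henon_0: "linear (henon (\<lambda>_. 0) c)"
    and entire_henon_0: "entire_map (henon (\<lambda>_. 0) c)"
    and norm_henon_0: "norm (henon (\<lambda>_. 0) c p) = cmod c * norm p"
proof -
  show lin: "linear (henon (\<lambda>_. 0) c)"
    by (rule linearI) (simp_all add: henon_def vec_eq_iff algebra_simps)
  have "bounded_linear (henon (\<lambda>_. 0) c)"
    using lin by (simp add: linear_conv_bounded_linear)
  then have "(henon (\<lambda>_. 0) c has_derivative henon (\<lambda>_. 0) c) (at a)" for a
    by (rule bounded_linear_imp_has_derivative)
  then show "entire_map (henon (\<lambda>_. 0) c)"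
    unfolding entire_map_def
    by (intro allI complex_matrix_of_derivative) (auto simp: henon_def vec_eq_iff)
  have "(norm (henon (\<lambda>_. 0) c p))\<^sup>2
      = (\<Sum>k<d. (cmod c)\<^sup>2 * (cmod (p $ e (Suc k)))\<^sup>2) + (cmod c)\<^sup>2 * (cmod (p $ e 0))\<^sup>2"
    by (simp add: norm_sum henon_less henon_last norm_mult power_mult_distrib flip: lessThan_Suc_atMost)
  also have "\<dots> = (cmod c * norm p)\<^sup>2"
    by (simp add: norm_sum power_mult_distrib sum.lessThan_Suc_shift distrib_left
        del: sum.lessThan_Suc flip: lessThan_Suc_atMost sum_distrib_left)
  finally show "norm (henon (\<lambda>_. 0) c p) = cmod c * norm p"
    by (simp add: power2_eq_iff_nonneg)
qed

text \<open>
  This is the quadratic error bound that linearization at \<open>0\<close> needs. The components of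
  \<open>henon_inv power2 c \<circ> henon (\<lambda>_. 0) c\<close> are the \<open>y\<^sub>k\<close> with \<open>y\<^sub>0 = p\<^sub>0\<close> and
  \<open>y\<^sub>k\<^sub>+\<^sub>1 = p\<^sub>k\<^sub>+\<^sub>1 - y\<^sub>k\<^sup>2 / c\<close>, so the bound follows by induction on \<open>k\<close>.
\<close>

lemma henon_inv_square_estimate:
  assumes c: "c \<noteq> 0"
  obtains Q where "0 < Q"
    "\<And>p q. norm p \<le> 1 \<Longrightarrow> norm q \<le> 1 \<Longrightarrow>
      norm (henon_inv power2 c (henon (\<lambda>_. 0) c p) - henon_inv power2 c (henon (\<lambda>_. 0) c q) - (p - q))
        \<le> Q * norm (p - q) * (norm p + norm q)"
proof -
  define y where "y = (\<lambda>k p. solve power2 c (henon (\<lambda>_. 0) c p) k)"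
  have y_0: "y 0 p = p $ e 0" for p
    using c by (simp add: y_def henon_last)
  have y_Suc: "y (Suc k) p = p $ e (Suc k) - (y k p)\<^sup>2 / c" if "k < d" for k p
    using c that by (simp add: y_def henon_less field_simps)
  have y_zero: "k \<le> d \<Longrightarrow> y k 0 = 0" for k
    by (induction k) (simp_all add: y_0 y_Suc)
  have "\<exists>C\<ge>0. \<forall>p q. norm p \<le> 1 \<longrightarrow> norm q \<le> 1 \<longrightarrow>
      cmod (y k p - y k q - (p $ e k - q $ e k)) \<le> C * norm (p - q) * (norm p + norm q)"
    if "k \<le> d" for k
    using that
  proof (induction k)
    case 0
    show ?case
      by (auto simp: y_0 intro: exI[of _ 0])
  next
    case (Suc k)
    then obtain C where C: "0 \<le> C" "\<And>p q. norm p \<le> 1 \<Longrightarrow> norm q \<le> 1 \<Longrightarrow>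
        cmod (y k p - y k q - (p $ e k - q $ e k)) \<le> C * norm (p - q) * (norm p + norm q)"
      by auto
    have lip: "cmod (y k p - y k q) \<le> (1 + 2 * C) * norm (p - q)"
      if "norm p \<le> 1" "norm q \<le> 1" for p q
    proof -
      have "cmod (y k p - y k q)
          \<le> cmod (y k p - y k q - (p $ e k - q $ e k)) + cmod ((p - q) $ e k)"
        using norm_triangle_ineq[of "y k p - y k q - (p $ e k - q $ e k)" "(p - q) $ e k"] by simp
      also have "\<dots> \<le> C * norm (p - q) * (norm p + norm q) + norm (p - q)"
        by (intro add_mono C(2) that Finite_Cartesian_Product.norm_nth_le)
      also have "\<dots> \<le> C * norm (p - q) * 2 + norm (p - q)"
        using that C(1) by (intro add_right_mono mult_left_mono) auto
      finally show ?thesis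
        by (simp add: algebra_simps)
    qed
    have bound: "cmod (y k p) \<le> (1 + 2 * C) * norm p" if "norm p \<le> 1" for p
      using lip[OF that, of 0] y_zero Suc.prems by simp
    show ?case
    proof (intro exI[of _ "(1 + 2 * C)\<^sup>2 / cmod c"] conjI allI impI)
      fix p q :: "complex ^ 'm" assume pq: "norm p \<le> 1" "norm q \<le> 1"
      have "y (Suc k) p - y (Suc k) q - (p $ e (Suc k) - q $ e (Suc k))
          = - ((y k p - y k q) * (y k p + y k q) / c)"
        using Suc.prems by (simp add: y_Suc power2_eq_square algebra_simps diff_divide_distrib)
      then have "cmod (y (Suc k) p - y (Suc k) q - (p $ e (Suc k) - q $ e (Suc k)))
          = cmod (y k p - y k q) * cmod (y k p + y k q) / cmod c"
        by (simp add: norm_mult norm_divide)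
      also have "\<dots> \<le> ((1 + 2 * C) * norm (p - q)) * ((1 + 2 * C) * (norm p + norm q)) / cmod c"
      proof (intro divide_right_mono mult_mono lip pq)
        show "cmod (y k p + y k q) \<le> (1 + 2 * C) * (norm p + norm q)"
          using bound[OF pq(1)] bound[OF pq(2)] norm_triangle_ineq[of "y k p" "y k q"]
          by (simp add: algebra_simps)
      qed (use C(1) in auto)
      finally show "cmod (y (Suc k) p - y (Suc k) q - (p $ e (Suc k) - q $ e (Suc k)))
          \<le> (1 + 2 * C)\<^sup>2 / cmod c * norm (p - q) * (norm p + norm q)"
        by (simp add: power2_eq_square mult_ac)
    qed simp
  qed
  then have "\<forall>i. \<exists>C\<ge>0. \<forall>p q. norm p \<le> 1 \<longrightarrow> norm q \<le> 1 \<longrightarrow>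
      cmod (y (pos i) p - y (pos i) q - (p $ i - q $ i)) \<le> C * norm (p - q) * (norm p + norm q)"
    by (metis ex_index pos_e)
  from choice[OF this] obtain C where C: "\<And>i. 0 \<le> C i" "\<And>i p q. norm p \<le> 1 \<Longrightarrow> norm q \<le> 1 \<Longrightarrow>
      cmod (y (pos i) p - y (pos i) q - (p $ i - q $ i)) \<le> C i * norm (p - q) * (norm p + norm q)"
    by blast
  show thesis
  proof (rule that)
    show "0 < 1 + (\<Sum>i\<in>UNIV. C i)"
      using C(1) by (simp add: add_pos_nonneg sum_nonneg)
    fix p q :: "complex ^ 'm" assume pq: "norm p \<le> 1" "norm q \<le> 1"
    let ?v = "henon_inv power2 c (henon (\<lambda>_. 0) c p) - henon_inv power2 c (henon (\<lambda>_. 0) c q) - (p - q)"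
    have "norm ?v \<le> (\<Sum>i\<in>UNIV. cmod (?v $ i))"
      by (rule norm_vec_le_sum)
    also have "\<dots> \<le> (\<Sum>i\<in>UNIV. C i * norm (p - q) * (norm p + norm q))"
      using C(2)[OF pq] by (intro sum_mono) (simp add: henon_inv_def y_def)
    also have "\<dots> = (\<Sum>i\<in>UNIV. C i) * (norm (p - q) * (norm p + norm q))"
      by (simp add: sum_distrib_right mult.assoc)
    also have "\<dots> \<le> (1 + (\<Sum>i\<in>UNIV. C i)) * (norm (p - q) * (norm p + norm q))"
      by (intro mult_right_mono) auto
    finally show "norm ?v \<le> (1 + (\<Sum>i\<in>UNIV. C i)) * norm (p - q) * (norm p + norm q)"
      by (simp only: mult.assoc)
  qed
qed

section \<open>A Fatou-Bieberbach domain avoiding a region at infinity\<close>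

text \<open>
  The region at infinity where a coordinate other than the last one dominates. In it the quadratic
  terms of the map outweigh the linear ones.
\<close>

definition escaping :: "complex ^ 'm \<Rightarrow> bool" where
  "escaping u \<longleftrightarrow> (\<exists>k<d. 2 \<le> cmod (u $ e k) \<and> (\<forall>i. cmod (u $ i) \<le> cmod (u $ e k)))"

text \<open>
  Only one coordinate has to be compared with the last one: the coordinate of largest modulus is
  then not the last one either.
\<close>

lemma escapingI:
  assumes k: "k < d" "2 \<le> cmod (u $ e k)" "cmod (u $ e d) < cmod (u $ e k)"
  shows "escaping u"
proof -
  have "Max (range (\<lambda>i. cmod (u $ i))) \<in> range (\<lambda>i. cmod (u $ i))"
    by (intro Max_in) auto
  then obtain i where i: "cmod (u $ i) = Max (range (\<lambda>i. cmod (u $ i)))"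
    by (metis imageE)
  then have max: "cmod (u $ j) \<le> cmod (u $ i)" for j
    by simp
  obtain l where l: "l \<le> d" "i = e l"
    by (rule ex_index)
  have "l \<noteq> d"
    using max[of "e k"] k l by auto
  then show ?thesis
    unfolding escaping_def using l max order_trans[OF k(2) max[of "e k"]] by (intro exI[of _ l]) auto
qed

lemma henon_escaping:
  assumes "escaping u"
  shows "escaping (henon power2 (1 / 2) u)"
proof -
  obtain k where k: "k < d" "2 \<le> cmod (u $ e k)" and max: "\<And>i. cmod (u $ i) \<le> cmod (u $ e k)"
    using assms unfolding escaping_def by blast
  let ?M = "cmod (u $ e k)"
  have "?M\<^sup>2 \<le> cmod (henon power2 (1 / 2) u $ e k) + cmod (u $ e (Suc k)) / 2"
    using norm_triangle_ineq4[of "henon power2 (1 / 2) u $ e k" "u $ e (Suc k) / 2"] k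
    by (simp add: henon_less norm_power norm_divide)
  moreover have "2 * ?M \<le> ?M\<^sup>2"
    using k(2) by (simp add: power2_eq_square mult_right_mono)
  ultimately have big: "3 / 2 * ?M \<le> cmod (henon power2 (1 / 2) u $ e k)"
    using max[of "e (Suc k)"] by simp
  have "cmod (henon power2 (1 / 2) u $ e d) \<le> ?M / 2"
    using max[of "e 0"] by (simp add: henon_last norm_divide)
  then show ?thesis
    using big k by (intro escapingI[of k]) auto
qed

text \<open>
  The image of the map lies in the basin of attraction of the fixed point \<open>0\<close> of the Henon-type map with
  \<open>\<phi>(w) = w\<^sup>2\<close> and \<open>c = 1/2\<close>. Orbits in the image tend to \<open>0\<close>, whereas orbits that start in the
  escape region remain in it and thus keep norm at least \<open>2\<close>.
\<close>

theorem ex_entire_injection_not_escaping: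
  obtains F :: "complex ^ 'm \<Rightarrow> complex ^ 'm"
  where "entire_map F" "inj F" "\<And>p. \<not> escaping (F p)"
proof -
  let ?A = "henon (\<lambda>_. 0) (1 / 2)" and ?H = "henon power2 (1 / 2)"
    and ?G = "henon_inv power2 (1 / 2)"
  have half: "(1 / 2 :: complex) \<noteq> 0"
    by simp
  obtain Q where Q: "0 < Q" "\<And>p q. norm p \<le> 1 \<Longrightarrow> norm q \<le> 1 \<Longrightarrow>
      norm (?G (?A p) - ?G (?A q) - (p - q)) \<le> Q * norm (p - q) * (norm p + norm q)"
    using henon_inv_square_estimate[OF half] by metis
  have "solve power2 (1 / 2) 0 k = 0" for k
    by (induction k) simp_all
  then have G0: "?G 0 = 0"
    by (simp add: henon_inv_def vec_eq_iff)
  have entire_G: "entire_map ?G"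
    by (intro entire_henon_inv holomorphic_intros)
  have norm_A: "norm (?A p) = 1 / 2 * norm p" for p
    by (simp add: norm_henon_0 norm_divide)
  have less: "0 < (1 / 2 :: real)" "1 / 2 < (1 :: real)"
    by simp_all
  obtain F where F: "entire_map F" "inj F" "F 0 = 0" and F_eq: "F = ?G \<circ> F \<circ> ?A"
    by (rule entire_linearization[OF entire_G inj_henon_inv[OF half] G0 entire_henon_0
          linear_henon_0 norm_A henon_henon_inv[OF half] less Q]) (assumption | rule that)+
  have conj: "F p = ?G (F (?A p))" for p
    using F_eq by (metis comp_apply)
  have "\<not> escaping (F p)" for p
  proof
    assume "escaping (F p)"
    have "escaping (F ((?A ^^ n) p))" for n
    proof (induction n)
      case 0
      show ?case
        using \<open>escaping (F p)\<close> by simp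
    next
      case (Suc n)
      have "?H (F ((?A ^^ n) p)) = F ((?A ^^ Suc n) p)"
        by (subst conj) (simp add: henon_henon_inv)
      then show ?case
        using henon_escaping[OF Suc] by simp
    qed
    then have "2 \<le> norm (F ((?A ^^ n) p))" for n
      unfolding escaping_def by (meson Finite_Cartesian_Product.norm_nth_le order_trans)
    moreover have "(\<lambda>n. F ((?A ^^ n) p)) \<longlonglongrightarrow> F 0"
    proof (rule isCont_tendsto_compose[where g = F])
      show "isCont F 0"
        using entire_map_continuous[OF F(1), of UNIV] by (simp add: continuous_on_eq_continuous_at)
      have "norm ((?A ^^ n) p) = (1 / 2) ^ n * norm p" for n
        by (induction n) (simp_all add: norm_henon_0 norm_divide)
      moreover have "(\<lambda>n. (1 / 2) ^ n * norm p) \<longlonglongrightarrow> 0 * norm p"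
        by (intro tendsto_mult_right LIMSEQ_realpow_zero) auto
      ultimately have "(\<lambda>n. norm ((?A ^^ n) p)) \<longlonglongrightarrow> 0"
        by simp
      then show "(\<lambda>n. (?A ^^ n) p) \<longlonglongrightarrow> 0"
        by (rule tendsto_norm_zero_cancel)
    qed
    then have "(\<lambda>n. norm (F ((?A ^^ n) p))) \<longlonglongrightarrow> 0"
      using F(3) tendsto_norm_zero by fastforce
    ultimately show False
      using LIMSEQ_le_const by fastforce
  qed
  then show thesis
    using F that by blast
qed

end

section \<open>Entire functions that are large on prescribed circles\<close>

text \<open>
  The circle on which the monomial has modulus \<open>1\<close> has radius \<open>3r/4\<close>, which lies between \<open>r/2\<close>
  and \<open>r\<close>; high powers are then tiny inside and huge outside.
\<close>

lemma ex_power_small_inside_large_on_circle: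
  fixes P :: "complex \<Rightarrow> complex"
  assumes P: "continuous_on UNIV P" and r: "0 < r" and \<epsilon>: "0 < \<epsilon>"
  obtains k where "\<And>\<zeta>. cmod \<zeta> \<le> r / 2 \<Longrightarrow> cmod ((4 * \<zeta> / (3 * of_real r)) ^ k) \<le> \<epsilon>"
    "\<And>\<zeta>. cmod \<zeta> = r \<Longrightarrow> b \<le> cmod (P \<zeta> + (4 * \<zeta> / (3 * of_real r)) ^ k)"
proof -
  have "bounded (P ` sphere 0 r)"
    using P by (meson compact_continuous_image compact_imp_bounded compact_sphere continuous_on_subset subset_UNIV)
  then obtain a where "\<forall>\<zeta>\<in>sphere 0 r. cmod (P \<zeta>) \<le> a"
    by (auto simp: bounded_iff)
  then have a: "cmod (P \<zeta>) \<le> a" if "cmod \<zeta> = r" for \<zeta>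
    using that by simp
  have "filterlim (\<lambda>k. (4 / 3 :: real) ^ k) at_top sequentially"
    using filterlim_at_infinity_imp_norm_at_top[OF filterlim_realpow_sequentially_gt1[of "4 / 3 :: real"]]
    by (simp add: norm_power)
  then have "\<forall>\<^sub>F k in sequentially. a + b \<le> (4 / 3) ^ k"
    by (simp add: filterlim_at_top)
  moreover have "\<forall>\<^sub>F k in sequentially. (2 / 3 :: real) ^ k < \<epsilon>"
    using LIMSEQ_realpow_zero[of "2 / 3 :: real"] \<epsilon> by (auto dest: order_tendstoD(2))
  ultimately have "\<forall>\<^sub>F k in sequentially. a + b \<le> (4 / 3) ^ k \<and> (2 / 3 :: real) ^ k < \<epsilon>"
    by eventually_elim simp
  then obtain k where k: "a + b \<le> (4 / 3) ^ k" "(2 / 3 :: real) ^ k < \<epsilon>"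
    by (auto simp: eventually_sequentially)
  have nrm: "cmod ((4 * \<zeta> / (3 * of_real r)) ^ k) = (4 / 3 * (cmod \<zeta> / r)) ^ k" for \<zeta>
    using r by (simp add: norm_power norm_mult norm_divide)
  show thesis
  proof (rule that)
    fix \<zeta> assume "cmod \<zeta> \<le> r / 2"
    then have "(4 / 3 * (cmod \<zeta> / r)) ^ k \<le> (2 / 3) ^ k"
      using r by (intro power_mono) (auto simp: field_simps)
    then show "cmod ((4 * \<zeta> / (3 * of_real r)) ^ k) \<le> \<epsilon>"
      using k by (simp add: nrm)
  next
    fix \<zeta> assume \<zeta>: "cmod \<zeta> = r"
    then have "cmod ((4 * \<zeta> / (3 * of_real r)) ^ k) = (4 / 3) ^ k"
      using r nrm by simp
    then show "b \<le> cmod (P \<zeta> + (4 * \<zeta> / (3 * of_real r)) ^ k)"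
      using k a[OF \<zeta>] norm_triangle_ineq4[of "P \<zeta> + (4 * \<zeta> / (3 * of_real r)) ^ k" "P \<zeta>"] by simp
  qed
qed

text \<open>
  One adds monomials one after the other: the monomial of stage \<open>n\<close> makes the function large on the
  circle of radius \<open>2\<^sup>n\<close> and leaves it almost unchanged on the smaller discs, hence does not spoil the
  circles treated before.
\<close>

theorem ex_entire_large_on_circles:
  fixes b :: "nat \<Rightarrow> real"
  obtains \<phi> where "\<phi> holomorphic_on UNIV" "\<And>n \<zeta>. cmod \<zeta> = 2 ^ n \<Longrightarrow> b n \<le> cmod (\<phi> \<zeta>)"
proof -
  have "\<exists>P :: nat \<Rightarrow> complex \<Rightarrow> complex. \<forall>n. P n holomorphic_on UNIV \<and>
      ((\<forall>\<zeta>. cmod \<zeta> \<le> 2 ^ n / 2 \<longrightarrow> cmod (P (Suc n) \<zeta> - P n \<zeta>) \<le> (1 / 2) ^ n) \<and>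
       (\<forall>\<zeta>. cmod \<zeta> = 2 ^ n \<longrightarrow> b n + 1 \<le> cmod (P (Suc n) \<zeta>)))"
  proof (rule dependent_nat_choice)
    show "\<exists>P. P holomorphic_on UNIV"
      by (auto intro: holomorphic_intros)
  next
    fix P :: "complex \<Rightarrow> complex" and n assume P: "P holomorphic_on UNIV"
    obtain k where k: "\<And>\<zeta>. cmod \<zeta> \<le> 2 ^ n / 2 \<Longrightarrow> cmod ((4 * \<zeta> / (3 * of_real (2 ^ n))) ^ k) \<le> (1 / 2) ^ n"
      "\<And>\<zeta>. cmod \<zeta> = 2 ^ n \<Longrightarrow> b n + 1 \<le> cmod (P \<zeta> + (4 * \<zeta> / (3 * of_real (2 ^ n))) ^ k)"
      by (rule ex_power_small_inside_large_on_circle[OF holomorphic_on_imp_continuous_on[OF P],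
            where r = "2 ^ n" and \<epsilon> = "(1 / 2) ^ n" and b = "b n + 1"]) auto
    show "\<exists>P'. P' holomorphic_on UNIV \<and>
        ((\<forall>\<zeta>. cmod \<zeta> \<le> 2 ^ n / 2 \<longrightarrow> cmod (P' \<zeta> - P \<zeta>) \<le> (1 / 2) ^ n) \<and>
         (\<forall>\<zeta>. cmod \<zeta> = 2 ^ n \<longrightarrow> b n + 1 \<le> cmod (P' \<zeta>)))"
      using k P
      by (intro exI[of _ "\<lambda>\<zeta>. P \<zeta> + (4 * \<zeta> / (3 * of_real (2 ^ n))) ^ k"]) (auto intro!: holomorphic_intros)
  qed
  then obtain P :: "nat \<Rightarrow> complex \<Rightarrow> complex" where hol: "\<And>n. P n holomorphic_on UNIV"
    and small: "\<And>n \<zeta>. cmod \<zeta> \<le> 2 ^ n / 2 \<Longrightarrow> cmod (P (Suc n) \<zeta> - P n \<zeta>) \<le> (1 / 2) ^ n"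
    and large: "\<And>n \<zeta>. cmod \<zeta> = 2 ^ n \<Longrightarrow> b n + 1 \<le> cmod (P (Suc n) \<zeta>)"
    by blast
  define \<phi> where "\<phi> = (\<lambda>\<zeta>. lim (\<lambda>n. P n \<zeta>))"
  have lim: "uniform_limit (ball 0 R) P \<phi> sequentially" for R
  proof -
    obtain n0 where n0: "R < 2 ^ n0"
      using real_arch_pow[of 2 R] by auto
    have "uniform_limit (ball 0 R) (\<lambda>n \<zeta>. \<Sum>k<n. P (Suc k) \<zeta> - P k \<zeta>)
        (\<lambda>\<zeta>. \<Sum>k. P (Suc k) \<zeta> - P k \<zeta>) sequentially"
    proof (rule Weierstrass_m_test_ev)
      have "cmod (P (Suc k) \<zeta> - P k \<zeta>) \<le> (1 / 2) ^ k" if k: "k \<ge> Suc n0" and "\<zeta> \<in> ball 0 R" for k \<zeta>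
      proof (rule small)
        have "(2::real) ^ Suc n0 \<le> 2 ^ k"
          using k by (intro power_increasing) auto
        then show "cmod \<zeta> \<le> 2 ^ k / 2"
          using that n0 by simp
      qed
      then show "\<forall>\<^sub>F k in sequentially. \<forall>\<zeta>\<in>ball 0 R. cmod (P (Suc k) \<zeta> - P k \<zeta>) \<le> (1 / 2) ^ k"
        unfolding eventually_sequentially by blast
      show "summable (\<lambda>k. (1 / 2 :: real) ^ k)"
        by (rule summable_geometric) simp
    qed
    from uniform_limit_add[OF this uniform_limit_const[where c = "P 0"]]
    have "uniform_limit (ball 0 R) P (\<lambda>\<zeta>. (\<Sum>k. P (Suc k) \<zeta> - P k \<zeta>) + P 0 \<zeta>) sequentially"
      by (simp add: sum_lessThan_telescope[of "\<lambda>n. P n _"])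
    then have "uniformly_convergent_on (ball 0 R) P"
      unfolding uniformly_convergent_on_def by blast
    then show ?thesis
      unfolding \<phi>_def uniformly_convergent_uniform_limit_iff .
  qed
  show thesis
  proof (rule that)
    show "\<phi> holomorphic_on UNIV"
    proof (rule holomorphic_uniform_sequence)
      show "\<exists>\<delta>>0. cball \<zeta> \<delta> \<subseteq> UNIV \<and> uniform_limit (cball \<zeta> \<delta>) P \<phi> sequentially" for \<zeta>
      proof (intro exI[of _ 1] conjI)
        have "cball \<zeta> 1 \<subseteq> ball 0 (cmod \<zeta> + 2)"
          by (simp add: cball_subset_ball_iff)
        then show "uniform_limit (cball \<zeta> 1) P \<phi> sequentially"
          using lim by (rule uniform_limit_on_subset[rotated])
      qed auto
    qed (use hol in auto)
    fix n \<zeta> assume \<zeta>: "cmod \<zeta> = 2 ^ n"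
    \<comment> \<open>The later corrections on this circle add up to at most \<open>1\<close>, the margin kept in the choice
        of \<open>P\<close>.\<close>
    have close: "cmod (P (Suc n + j) \<zeta> - P (Suc n) \<zeta>) \<le> 1 - (1 / 2) ^ j" for j
    proof (induction j)
      case (Suc j)
      have "cmod (P (Suc n + Suc j) \<zeta> - P (Suc n + j) \<zeta>) \<le> (1 / 2) ^ (Suc n + j)"
        using small[of \<zeta> "Suc n + j"] power_increasing[of n "n + j" "2 :: real"] by (simp add: \<zeta>)
      also have "\<dots> \<le> (1 / 2) ^ Suc j"
        by (rule power_decreasing) auto
      finally have "cmod (P (Suc n + Suc j) \<zeta> - P (Suc n + j) \<zeta>) \<le> (1 / 2) ^ Suc j" .
      then show ?case
        using Suc norm_triangle_ineq[of "P (Suc n + Suc j) \<zeta> - P (Suc n + j) \<zeta>"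
            "P (Suc n + j) \<zeta> - P (Suc n) \<zeta>"]
        by simp
    qed simp
    have "(\<lambda>j. P (Suc n + j) \<zeta>) \<longlonglongrightarrow> \<phi> \<zeta>"
      using LIMSEQ_ignore_initial_segment[OF tendsto_uniform_limitI[OF lim[of "2 ^ n + 1"], of \<zeta>], of "Suc n"] \<zeta>
      by (simp add: add.commute)
    then have "(\<lambda>j. cmod (P (Suc n + j) \<zeta>)) \<longlonglongrightarrow> cmod (\<phi> \<zeta>)"
      by (rule tendsto_norm)
    moreover have "b n \<le> cmod (P (Suc n + j) \<zeta>)" for j
    proof -
      have "cmod (P (Suc n) \<zeta>) \<le> cmod (P (Suc n + j) \<zeta>) + cmod (P (Suc n + j) \<zeta> - P (Suc n) \<zeta>)"
        using norm_triangle_ineq4[of "P (Suc n + j) \<zeta>" "P (Suc n + j) \<zeta> - P (Suc n) \<zeta>"] by simp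
      moreover have "0 \<le> (1 / 2 :: real) ^ j"
        by simp
      ultimately show ?thesis
        using large[OF \<zeta>] close[of j] by linarith
    qed
    ultimately show "b n \<le> cmod (\<phi> \<zeta>)"
      by (intro LIMSEQ_le_const) auto
  qed
qed

section \<open>The walls\<close>

lemma frontier_unit_polydisk:
  assumes "w \<in> frontier (unit_polydisk :: (complex ^ 'm) set)"
  obtains i where "cmod (w $ i) = 1" "\<And>j. cmod (w $ j) \<le> 1"
proof -
  have "open (\<Inter>i. {w :: complex ^ 'm. cmod (w $ i) < 1})"
    by (intro open_INT ballI open_Collect_less continuous_intros) auto
  then have op: "open (unit_polydisk :: (complex ^ 'm) set)"
    by (simp add: unit_polydisk_def Collect_all_eq)
  have "closed {w :: complex ^ 'm. \<forall>i. cmod (w $ i) \<le> 1}"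
    by (intro closed_Collect_all closed_Collect_le continuous_intros)
  then have "closure unit_polydisk \<subseteq> {w :: complex ^ 'm. \<forall>i. cmod (w $ i) \<le> 1}"
    by (intro closure_minimal) (auto simp: unit_polydisk_def less_imp_le)
  then have le: "cmod (w $ j) \<le> 1" for j
    using assms by (auto simp: frontier_def)
  moreover have "w \<notin> unit_polydisk"
    using assms op by (simp add: frontier_def interior_open)
  then obtain i where "\<not> cmod (w $ i) < 1"
    by (auto simp: unit_polydisk_def)
  then have "cmod (w $ i) = 1"
    using le[of i] by simp
  ultimately show thesis
    using that by blast
qed

lemma K_set_cases:
  assumes "p \<in> K_set C"
  obtains n i where "cmod (p $ Inl i) = 2 ^ n" "\<And>j. cmod (p $ Inl j) \<le> 2 ^ n"
    "cmod (p $ Inr ()) \<le> \<bar>C (Suc n)\<bar>"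
proof -
  obtain N w \<zeta> where N: "N \<ge> 1" and w: "w \<in> frontier unit_polydisk" "xy_part p = 2 ^ (N - 1) *\<^sub>R w"
    and \<zeta>: "cmod \<zeta> \<le> 1" "z_part p = C N *\<^sub>R \<zeta>"
    using assms unfolding K_set_def by (auto simp: image_iff)
  have p: "cmod (p $ Inl j) = 2 ^ (N - 1) * cmod (w $ j)" for j
    using arg_cong[OF w(2), of "\<lambda>v. cmod (v $ j)"] by (simp add: xy_part_def)
  obtain i where "cmod (w $ i) = 1" "\<And>j. cmod (w $ j) \<le> 1"
    using frontier_unit_polydisk[OF w(1)] by metis
  moreover have "cmod (p $ Inr ()) \<le> \<bar>C (Suc (N - 1))\<bar>"
    using \<zeta> N by (simp add: z_part_def mult_left_le)
  ultimately show thesis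
    by (intro that[of i "N - 1"]) (simp_all add: p)
qed

lemma fatou_bieberbach_domain_range:
  fixes F :: "complex ^ 'm \<Rightarrow> complex ^ 'm"
  assumes F: "entire_map F" "inj F" "range F \<noteq> UNIV"
  shows "fatou_bieberbach_domain (range F)"
  unfolding fatou_bieberbach_domain_def
proof (intro conjI exI[of _ F])
  have "continuous_on UNIV F"
    using F(1) by (rule entire_map_continuous)
  then show "open (range F)" "connected (range F)"
    using invariance_of_domain[OF _ open_UNIV F(2)] connected_continuous_image[OF _ connected_UNIV]
    by blast+
qed (rule F refl | simp)+

theorem proposition1p4:
  fixes C :: "nat \<Rightarrow> real"
  assumes "\<And>N. N \<ge> 1 \<Longrightarrow> C N > 0"
  shows "\<exists>\<Omega> :: (complex ^ ('n::finite) coords) set.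
           fatou_bieberbach_domain \<Omega> \<and> \<Omega> \<subseteq> UNIV - K_set C"
proof -
  \<comment> \<open>Enumerate the coordinates with \<open>z\<close> as the last one.\<close>
  define d where "d = card (range Inl :: 'n coords set)"
  obtain e0 where e0: "bij_betw e0 {0..<d} (range Inl :: 'n coords set)"
    unfolding d_def using ex_bij_betw_nat_finite[OF finite] by metis
  define e where "e = (\<lambda>k. if k < d then e0 k else (Inr () :: 'n coords))"
  have e_last: "e d = Inr ()"
    by (simp add: e_def)
  have UNIV_coords: "(UNIV :: 'n coords set) = range Inl \<union> {Inr ()}"
    by (metis UNIV_sum UNIV_unit image_empty image_insert)
  have e_Inl: "bij_betw e {..<d} (range Inl)"
    using e0 by (subst bij_betw_cong[of _ _ e0]) (auto simp: e_def lessThan_atLeast0)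
  interpret coordinate_enumeration e d
  proof
    have "bij_betw e ({..<d} \<union> {d}) (range Inl \<union> {Inr ()})"
      using e_Inl by (rule bij_betw_combine) (auto simp: e_last bij_betw_def)
    then show "bij_betw e {..d} UNIV"
      unfolding UNIV_coords by (simp add: lessThan_Suc_atMost[symmetric] lessThan_Suc)
    show "0 < d"
      by (simp add: d_def card_gt_0_iff)
  qed
  \<comment> \<open>On the wall of index \<open>n + 1\<close> every coordinate has modulus at most \<open>2\<^sup>n + C\<^sub>n\<^sub>+\<^sub>1\<close>. The bound for
      \<open>\<phi>\<close> exceeds this by \<open>2\<^sup>n + 2\<close>, so a coordinate of modulus \<open>2\<^sup>n\<close> is mapped to one that is
      larger than the new last coordinate, which is an old \<open>x\<close> or \<open>y\<close> coordinate.\<close>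
  obtain \<phi> where \<phi>: "\<phi> holomorphic_on UNIV"
    "\<And>n \<zeta>. cmod \<zeta> = 2 ^ n \<Longrightarrow> 2 * 2 ^ n + \<bar>C (Suc n)\<bar> + 2 \<le> cmod (\<phi> \<zeta>)"
    using ex_entire_large_on_circles[of "\<lambda>n. 2 * 2 ^ n + \<bar>C (Suc n)\<bar> + 2"] by blast
  have K_escaping: "escaping (henon \<phi> 1 p)" if "p \<in> K_set C" for p
  proof -
    obtain n i where p: "cmod (p $ Inl i) = 2 ^ n" "\<And>j. cmod (p $ Inl j) \<le> 2 ^ n"
      "cmod (p $ Inr ()) \<le> \<bar>C (Suc n)\<bar>"
      using K_set_cases[OF \<open>p \<in> K_set C\<close>] by metis
    obtain k where k: "k < d" "e k = Inl i"
      using e_Inl by (metis bij_betw_imp_surj_on imageE lessThan_iff rangeI)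
    have p_le: "cmod (p $ j) \<le> 2 ^ n + \<bar>C (Suc n)\<bar>" for j
    proof (cases j)
      case (Inl i)
      then show ?thesis
        using p(2)[of i] by simp
    next
      case (Inr u)
      then show ?thesis
        using p(3) by (cases u) (simp add: add_increasing)
    qed
    have "2 * 2 ^ n + \<bar>C (Suc n)\<bar> + 2 \<le> cmod (\<phi> (p $ e k))"
      using p(1) k(2) by (intro \<phi>(2)) simp
    then have big: "2 ^ n + 2 \<le> cmod (henon \<phi> 1 p $ e k)"
      using p_le[of "e (Suc k)"] norm_triangle_ineq4[of "henon \<phi> 1 p $ e k" "p $ e (Suc k)"] k(1)
      by (simp add: henon_less)
    obtain l where "e 0 = Inl l"
      using e_Inl d by (metis bij_betw_imp_surj_on imageE imageI lessThan_iff)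
    then have "cmod (henon \<phi> 1 p $ e d) \<le> 2 ^ n"
      using p(2) by (simp add: henon_last)
    then show ?thesis
      using big k(1) by (intro escapingI[of k]) (auto intro: order_trans[rotated])
  qed
  obtain F :: "complex ^ 'n coords \<Rightarrow> complex ^ 'n coords"
    where F: "entire_map F" "inj F" "\<And>p. \<not> escaping (F p)"
    using ex_entire_injection_not_escaping by blast
  define \<Phi> where "\<Phi> = (\<lambda>p. henon_inv \<phi> 1 (F p))"
  have not_escaping: "\<not> escaping (henon \<phi> 1 q)" if "q \<in> range \<Phi>" for q
    using that F(3) by (auto simp: \<Phi>_def henon_henon_inv)
  have "entire_map \<Phi>"
    unfolding \<Phi>_def by (rule entire_map_compose[OF F(1) entire_henon_inv[OF \<phi>(1)]])
  moreover have "inj \<Phi>"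
    using inj_compose[OF inj_henon_inv[of 1 \<phi>] F(2)] by (simp add: \<Phi>_def o_def)
  moreover have "range \<Phi> \<noteq> UNIV"
  proof
    assume "range \<Phi> = UNIV"
    have "escaping (\<chi> i. 2)"
      unfolding escaping_def using d by auto
    then show False
      using not_escaping[of "henon_inv \<phi> 1 (\<chi> i. 2)"] \<open>range \<Phi> = UNIV\<close> by (simp add: henon_henon_inv)
  qed
  ultimately have "fatou_bieberbach_domain (range \<Phi>)"
    by (rule fatou_bieberbach_domain_range)
  moreover have "range \<Phi> \<subseteq> UNIV - K_set C"
    using K_escaping not_escaping by blast
  ultimately show ?thesis
    by blast
qed

end
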